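(* Let $n\ge 1$ and let $G$ be a simple undirected graph with vertex set $[n]=\{1,\dots,n\}$. Then there are poset isomorphisms $$\mathcal L(\mathcal H_{2n-3}(G))\cong\mathcal L(\mathcal A_{\Gamma_G})\cong\Pi_{\Gamma_G}.$$
   Context: Homogenized graphical Shi arrangement: $\mathcal H_{2n-3}(G)$ is the hyperplane arrangement in $\mathbb R^{2n-1}$ with coordinates $(x_1,\dots,x_n,y_1,\dots,y_{n-1})$ consisting of the hyperplanes $x_i-x_j=0$ for $i<j$, $\{i,j\}\in E(G)$, and $x_i-x_j=y_i$ for $1\le i<j\le n$. The graph $\Gamma_G$ has vertex set $\{1,3,\dots,2n-1\}\sqcup\{2,4,\dots,2n-2\}=[2n-1]$ and the following edges: $\{2n-2i+1,2n-2j+1\}$ for each edge $\{i,j\}\in E(G)$; and $\{2i-1,2j\}$ whenever $1\le i\le j\le n-1$. $\mathcal A_{\Gamma_G}$ is the graphical arrangement of $\Gamma_G$ in $\mathbb R^{2n-1}$: the hyperplanes $z_u=z_v$ for $\{u,v\}\in E(\Gamma_G)$. For an arrangement $\mathcal A$, $\mathcal L(\mathcal A)$ is the set of all nonempty intersections of hyperplanes of $\mathcal A$ (including the ambient space as the empty intersection), ordered by reverse inclusion. For a finite graph $\Gamma=(V,E)$, the bond lattice $\Pi_\Gamma$ is the poset of set partitions of $V$ all of whose blocks induce connected subgraphs of $\Gamma$, ordered by $\pi\le\pi'$ iff every block of $\pi$ is contained in a block of $\pi'$. *)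

theory Defs
  imports
    Complex_Main
    "HOL-Library.FuncSet"
    "HOL-Library.Disjoint_Sets"
    "Graph_Theory.Digraph_Component"
begin

text \<open>
  A finite simple undirected graph is a \<open>pair_graph\<close>: a finite loop-free digraph with symmetric arc
  set, an edge \<open>{i, j}\<close> being the pair of arcs \<open>(i, j)\<close>, \<open>(j, i)\<close>.
  The space of real vectors with coordinates indexed by \<open>I\<close> consists of the functions that are
  \<open>undefined\<close> outside \<open>I\<close>, so that distinct elements differ in some coordinate.
\<close>

definition coord_space :: "'i set \<Rightarrow> ('i \<Rightarrow> real) set" where
  "coord_space I = I \<rightarrow>\<^sub>E UNIV"

text \<open>
  The ambient space \<open>V\<close> is a parameter because the empty intersection is to be read as \<open>V\<close>,
  whereas \<open>\<Inter>{}\<close> is \<open>UNIV\<close>.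
\<close>

definition intersection_poset :: "'a set \<Rightarrow> 'a set set \<Rightarrow> 'a set set" where
  "intersection_poset V A = {X. X \<noteq> {} \<and> (\<exists>B \<subseteq> A. X = V \<inter> \<Inter>B)}"

definition rev_incl :: "'a set \<Rightarrow> 'a set \<Rightarrow> bool" where
  "rev_incl X Y \<longleftrightarrow> Y \<subseteq> X"

definition poset_isomorphic ::
    "'a set \<Rightarrow> ('a \<Rightarrow> 'a \<Rightarrow> bool) \<Rightarrow> 'b set \<Rightarrow> ('b \<Rightarrow> 'b \<Rightarrow> bool) \<Rightarrow> bool" where
  "poset_isomorphic P le Q le' \<longleftrightarrow>
     (\<exists>f. bij_betw f P Q \<and> (\<forall>a\<in>P. \<forall>b\<in>P. le a b \<longleftrightarrow> le' (f a) (f b)))"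

definition graphical_arrangement :: "'v pair_pre_digraph \<Rightarrow> ('v \<Rightarrow> real) set set" where
  "graphical_arrangement \<Gamma> =
     {{z \<in> coord_space (pverts \<Gamma>). z u = z v} | u v. (u, v) \<in> parcs \<Gamma>}"

text \<open>The order on the bond lattice is \<^const>\<open>refines\<close>.\<close>

definition bond_lattice :: "'v pair_pre_digraph \<Rightarrow> 'v set set set" where
  "bond_lattice \<Gamma> =
     {\<pi>. partition_on (pverts \<Gamma>) \<pi> \<and>
         (\<forall>B\<in>\<pi>. Digraph_Component.connected (with_proj \<Gamma> \<restriction> B))}"

text \<open>
  A point \<open>p\<close> has coordinates \<open>x\<^sub>i = p i\<close> for \<open>1 \<le> i \<le> n\<close> and
  \<open>y\<^sub>i = p (n + i)\<close> for \<open>1 \<le> i \<le> n - 1\<close>.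
\<close>

definition hom_shi_arrangement :: "nat \<Rightarrow> nat pair_pre_digraph \<Rightarrow> (nat \<Rightarrow> real) set set" where
  "hom_shi_arrangement n G =
     {{p \<in> coord_space {1..2*n-1}. p i - p j = 0} | i j. i < j \<and> (i, j) \<in> parcs G} \<union>
     {{p \<in> coord_space {1..2*n-1}. p i - p j = p (n + i)} | i j. 1 \<le> i \<and> i < j \<and> j \<le> n}"

text \<open>The last two sets contain the two orientations of the edges \<open>{2 i - 1, 2 j}\<close>.\<close>

definition Gamma :: "nat \<Rightarrow> nat pair_pre_digraph \<Rightarrow> nat pair_pre_digraph" where
  "Gamma n G = \<lparr> pverts = {1..2*n-1},
     parcs = {(2*n - 2*i + 1, 2*n - 2*j + 1) | i j. (i, j) \<in> parcs G} \<union>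
             {(2*i - 1, 2*j) | i j. 1 \<le> i \<and> i \<le> j \<and> j \<le> n - 1} \<union>
             {(2*j, 2*i - 1) | i j. 1 \<le> i \<and> i \<le> j \<and> j \<le> n - 1} \<rparr>"

lemma pair_graph_Gamma:
  assumes "pair_graph G" and "pverts G = {1..n}"
  shows "pair_graph (Gamma n G)"
proof -
  interpret G: pair_graph G by fact
  have V: "1 \<le> i \<and> i \<le> n \<and> 1 \<le> j \<and> j \<le> n \<and> i \<noteq> j" if "(i, j) \<in> parcs G" for i j
    using G.wellformed'[OF that] G.no_loops[OF that] assms(2) by auto
  have S: "(j, i) \<in> parcs G" if "(i, j) \<in> parcs G" for i j
    using G.pair_sym_arcs that by (auto simp: symmetric_def elim: symE)
  have verts: "pverts (Gamma n G) = {1..2*n-1}"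
    by (simp add: Gamma_def)
  have arc: "u \<in> {1..2*n-1} \<and> v \<in> {1..2*n-1} \<and> u \<noteq> v \<and> (v, u) \<in> parcs (Gamma n G)"
    if uv: "(u, v) \<in> parcs (Gamma n G)" for u v
  proof -
    consider
        (odd) i j where "u = 2*n - 2*i + 1" "v = 2*n - 2*j + 1" "(i, j) \<in> parcs G"
      | (up) i j where "u = 2*i - 1" "v = 2*j" "1 \<le> i" "i \<le> j" "j \<le> n - 1"
      | (down) i j where "u = 2*j" "v = 2*i - 1" "1 \<le> i" "i \<le> j" "j \<le> n - 1"
      using uv unfolding Gamma_def by fastforce
    then show ?thesis
    proof cases
      case odd
      have "(v, u) \<in> parcs (Gamma n G)"
        unfolding Gamma_def using odd(1,2) S[OF odd(3)] by fastforce
      then show ?thesis using odd(1,2) V[OF odd(3)] by auto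
    next
      case up
      have "(v, u) \<in> parcs (Gamma n G)"
        unfolding Gamma_def using up by fastforce
      moreover have "u \<noteq> v" using up(1-3) by presburger
      ultimately show ?thesis using up by auto
    next
      case down
      have "(v, u) \<in> parcs (Gamma n G)"
        unfolding Gamma_def using down by fastforce
      moreover have "u \<noteq> v" using down(1-3) by presburger
      ultimately show ?thesis using down by auto
    qed
  qed
  have sub: "parcs (Gamma n G) \<subseteq> {1..2*n-1} \<times> {1..2*n-1}"
    by (rule subrelI) (use arc in blast)
  show ?thesis
  proof
    fix e assume "e \<in> parcs (Gamma n G)"
    then have "(fst e, snd e) \<in> parcs (Gamma n G)" by simp
    from arc[OF this]
    show "fst e \<in> pverts (Gamma n G)" "snd e \<in> pverts (Gamma n G)" "fst e \<noteq> snd e"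
      unfolding verts by blast+
  next
    show "finite (pverts (Gamma n G))" by (simp add: verts)
    show "finite (parcs (Gamma n G))" by (rule finite_subset[OF sub]) simp
    show "symmetric (with_proj (Gamma n G))"
      unfolding symmetric_def with_proj_simps by (rule symI) (use arc in blast)
  qed
qed

end

theory Submission
  imports Defs
begin

text \<open>
  Put \<open>z\<^sub>k = x\<^sub>i\<close> for \<open>k = 2n - 2i + 1\<close> and \<open>z\<^sub>k = x\<^sub>m - y\<^sub>m\<close> for \<open>k = 2n - 2m\<close>. This is an
  invertible linear change of coordinates which turns \<open>x\<^sub>i = x\<^sub>j\<close> and \<open>x\<^sub>m - x\<^sub>j = y\<^sub>m\<close>, \<open>m < j\<close>, into
  the hyperplanes of the arcs of \<open>\<Gamma>\<^sub>G\<close>.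

  For any graph, a bond corresponds to the flat of the vectors that are constant on its blocks. The
  flat given by a set of edges comes from the partition into the connected components of these
  edges, and the indicator of a block of \<open>\<pi>'\<close>, which lies in the flat of \<open>\<pi>'\<close>, shows that inclusion
  of flats forces refinement.
\<close>

section \<open>Poset isomorphisms and transport of intersection posets\<close>

lemma poset_isomorphic_sym:
  assumes "poset_isomorphic P le Q le'"
  shows "poset_isomorphic Q le' P le"
proof -
  obtain f where f: "bij_betw f P Q" "\<forall>a\<in>P. \<forall>b\<in>P. le a b \<longleftrightarrow> le' (f a) (f b)"
    using assms unfolding poset_isomorphic_def by blast
  let ?g = "inv_into P f"
  have g: "?g a \<in> P" "f (?g a) = a" if "a \<in> Q" for a
    using f(1) that by (auto simp: bij_betw_def inv_into_into f_inv_into_f)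
  have "le' a b \<longleftrightarrow> le (?g a) (?g b)" if "a \<in> Q" "b \<in> Q" for a b
    using f(2) g[OF that(1)] g[OF that(2)] by metis
  with bij_betw_inv_into[OF f(1)] show ?thesis
    unfolding poset_isomorphic_def by blast
qed

text \<open>Injectivity comes from the order: if \<open>f a = f b\<close>, reflexivity of
  \<open>le'\<close> at this value, pulled back through \<open>emb\<close>, gives
  \<open>le a b\<close> and \<open>le b a\<close>. So only surjectivity and the equivalence of the
  orders remain to be checked in the applications.\<close>

lemma poset_isomorphic_surj_embedding:
  assumes "f ` P = Q"
    and emb: "\<And>a b. a \<in> P \<Longrightarrow> b \<in> P \<Longrightarrow> le a b \<longleftrightarrow> le' (f a) (f b)"
    and antisym: "\<And>a b. a \<in> P \<Longrightarrow> b \<in> P \<Longrightarrow> le a b \<Longrightarrow> le b a \<Longrightarrow> a = b"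
    and refl: "\<And>b. b \<in> Q \<Longrightarrow> le' b b"
  shows "poset_isomorphic P le Q le'"
proof -
  have "inj_on f P"
  proof (rule inj_onI)
    fix a b assume ab: "a \<in> P" "b \<in> P" "f a = f b"
    then have "le' (f a) (f a)" using assms(1) refl by blast
    then show "a = b" using antisym emb ab by metis
  qed
  with assms(1) emb show ?thesis
    unfolding poset_isomorphic_def bij_betw_def by blast
qed

lemma image_restricted_Inter:
  assumes "inj_on f V" and "\<And>H. H \<in> B \<Longrightarrow> H \<subseteq> V"
  shows "f ` (V \<inter> \<Inter>B) = f ` V \<inter> \<Inter>((`) f ` B)"
proof
  show "f ` V \<inter> \<Inter>((`) f ` B) \<subseteq> f ` (V \<inter> \<Inter>B)"
  proof
    fix y assume y: "y \<in> f ` V \<inter> \<Inter>((`) f ` B)"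
    then obtain x where x: "x \<in> V" "y = f x" by blast
    have "x \<in> H" if "H \<in> B" for H
    proof -
      have "y \<in> f ` H" using y that by blast
      then have "f x \<in> f ` H" using x(2) by simp
      then show ?thesis using inj_on_image_mem_iff[OF assms(1) x(1) assms(2)[OF that]] by simp
    qed
    then have "x \<in> V \<inter> \<Inter>B" using x(1) by blast
    then show "y \<in> f ` (V \<inter> \<Inter>B)" unfolding x(2) by (rule imageI)
  qed
qed auto

text \<open>Taking images commutes with intersecting subfamilies of \<open>A\<close>, so flats go
  onto flats, and the image map of an injection both preserves and reflects inclusion of subsets of
  \<open>V\<close>.\<close>

lemma poset_isomorphic_intersection_poset:
  assumes bij: "bij_betw f V V'" and img: "(`) f ` A = A'"
    and sub: "\<And>H. H \<in> A \<Longrightarrow> H \<subseteq> V"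
  shows "poset_isomorphic (intersection_poset V A) rev_incl (intersection_poset V' A') rev_incl"
proof (rule poset_isomorphic_surj_embedding)
  have inj: "inj_on f V" and fV: "f ` V = V'" using bij by (auto simp: bij_betw_def)
  have Int: "f ` (V \<inter> \<Inter>B) = V' \<inter> \<Inter>((`) f ` B)" if "B \<subseteq> A" for B
    using image_restricted_Inter[OF inj, of B] sub that fV by blast
  show "(`) f ` intersection_poset V A = intersection_poset V' A'"
  proof (intro equalityI subsetI)
    fix Y assume "Y \<in> (`) f ` intersection_poset V A"
    then obtain B where B: "B \<subseteq> A" "Y = f ` (V \<inter> \<Inter>B)" "Y \<noteq> {}"
      unfolding intersection_poset_def by blast
    then have "(`) f ` B \<subseteq> A'" "Y = V' \<inter> \<Inter>((`) f ` B)" using Int img by auto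
    then show "Y \<in> intersection_poset V' A'"
      using B(3) unfolding intersection_poset_def by blast
  next
    fix Y assume "Y \<in> intersection_poset V' A'"
    then obtain C where C: "C \<subseteq> A'" "Y = V' \<inter> \<Inter>C" "Y \<noteq> {}"
      unfolding intersection_poset_def by blast
    then obtain B where B: "B \<subseteq> A" "C = (`) f ` B"
      using img by (metis subset_imageE)
    have Y: "Y = f ` (V \<inter> \<Inter>B)" using Int B C by simp
    with C(3) B(1) have "V \<inter> \<Inter>B \<in> intersection_poset V A"
      unfolding intersection_poset_def by blast
    with Y show "Y \<in> (`) f ` intersection_poset V A" by blast
  qed
  show "rev_incl X Y \<longleftrightarrow> rev_incl (f ` X) (f ` Y)"
    if "X \<in> intersection_poset V A" "Y \<in> intersection_poset V A" for X Y
  proof -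
    have "X \<subseteq> V" "Y \<subseteq> V" using that unfolding intersection_poset_def by auto
    then have "f ` Y \<subseteq> f ` X \<longleftrightarrow> Y \<subseteq> X"
      using inj_on_image_mem_iff[OF inj _ \<open>X \<subseteq> V\<close>] by blast
    then show ?thesis by (simp add: rev_incl_def)
  qed
qed (auto simp: rev_incl_def)

lemma image_Collect_bij_betw:
  assumes "bij_betw f V W" and "\<And>x. x \<in> V \<Longrightarrow> P x \<longleftrightarrow> Q (f x)"
  shows "f ` {x \<in> V. P x} = {y \<in> W. Q y}"
  using assms by (auto simp: bij_betw_def)

section \<open>Bonds and flats of a graphical arrangement\<close>

text \<open>Connectedness is defined through the symmetric closure of the arcs, which changes
  nothing for a symmetric arc set. For endpoints in \<open>B\<close>, \<open>rtrancl_on\<close>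
  agrees with the plain closure, which is better suited to induction along walks.\<close>

lemma connected_induce_subgraph_iff:
  assumes "pair_graph \<Gamma>"
  shows "Digraph_Component.connected (with_proj \<Gamma> \<restriction> B) \<longleftrightarrow>
    B \<noteq> {} \<and> (\<forall>u\<in>B. \<forall>v\<in>B. (u, v) \<in> (parcs \<Gamma> \<inter> B \<times> B)\<^sup>*)"
proof -
  interpret pair_graph \<Gamma> by fact
  let ?E = "parcs \<Gamma> \<inter> B \<times> B"
  have E: "arcs_ends (with_proj \<Gamma> \<restriction> B) = ?E"
    by (auto simp: arcs_ends_def arc_to_ends_def)
  have "?E\<^sup>s = ?E"
    using pair_sym_arcs by (auto simp: symcl_def symmetric_def elim: symE)
  moreover have "(u, v) \<in> rtrancl_on B ?E \<longleftrightarrow> (u, v) \<in> ?E\<^sup>*" if "u \<in> B" "v \<in> B" for u v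
    using that by (auto intro: rtrancl_consistent_rtrancl_on dest: rtrancl_on_rtranclI)
  ultimately show ?thesis
    unfolding connected_conv E by auto
qed

definition partition_flat :: "'v set \<Rightarrow> 'v set set \<Rightarrow> ('v \<Rightarrow> real) set" where
  "partition_flat V \<pi> = {z \<in> coord_space V. \<forall>C\<in>\<pi>. \<forall>u\<in>C. \<forall>v\<in>C. z u = z v}"

lemma partition_flatI:
  assumes "z \<in> coord_space V"
    and "\<And>C u v. C \<in> \<pi> \<Longrightarrow> u \<in> C \<Longrightarrow> v \<in> C \<Longrightarrow> z u = z v"
  shows "z \<in> partition_flat V \<pi>"
  using assms unfolding partition_flat_def by blast

lemma partition_flatD:
  assumes "z \<in> partition_flat V \<pi>"
  shows "z \<in> coord_space V" and "C \<in> \<pi> \<Longrightarrow> u \<in> C \<Longrightarrow> v \<in> C \<Longrightarrow> z u = z v"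
  using assms unfolding partition_flat_def by blast+

text \<open>A coarser partition imposes more equations and so has the smaller flat; this is why
  refinement matches reverse inclusion.\<close>

lemma refines_iff_partition_flat:
  assumes P: "partition_on V P" and Q: "partition_on V Q"
  shows "refines V P Q \<longleftrightarrow> partition_flat V Q \<subseteq> partition_flat V P"
proof
  assume "refines V P Q"
  then have *: "\<forall>X\<in>P. \<exists>Y\<in>Q. X \<subseteq> Y" by (simp add: refines_def)
  show "partition_flat V Q \<subseteq> partition_flat V P"
  proof
    fix z assume z: "z \<in> partition_flat V Q"
    have "z u = z v" if C: "C \<in> P" "u \<in> C" "v \<in> C" for C u v
    proof -
      obtain D where "D \<in> Q" "C \<subseteq> D" using * C(1) by blast
      then have "D \<in> Q" "u \<in> D" "v \<in> D" using C(2,3) by auto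
      then show ?thesis by (rule partition_flatD(2)[OF z])
    qed
    then show "z \<in> partition_flat V P" by (rule partition_flatI[OF partition_flatD(1)[OF z]])
  qed
next
  assume sub: "partition_flat V Q \<subseteq> partition_flat V P"
  have "\<exists>Y\<in>Q. X \<subseteq> Y" if X: "X \<in> P" for X
  proof -
    obtain x where x: "x \<in> X" using X P unfolding partition_on_def by fastforce
    have XV: "X \<subseteq> V" using X P unfolding partition_on_def by blast
    then obtain Y where Y: "Y \<in> Q" "x \<in> Y" using x Q unfolding partition_on_def by blast
    \<comment> \<open>The indicator of the block \<open>Y\<close> of \<open>Q\<close> through
      \<open>x\<close>, made \<open>undefined\<close> outside \<open>V\<close> so as to lie in
      \<open>coord_space V\<close>. It is constant on every block of \<open>Q\<close>, hence by
      \<open>sub\<close> on \<open>X\<close>, where its value at \<open>x\<close> is 1; so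
      \<open>X\<close> lies inside \<open>Y\<close>.\<close>
    define z where "z = restrict (\<lambda>v. of_bool (v \<in> Y) :: real) V"
    have "z u = z v" if "C \<in> Q" "u \<in> C" "v \<in> C" for C u v
    proof -
      have "u \<in> V" "v \<in> V" using that Q unfolding partition_on_def by blast+
      moreover have "u \<in> Y \<longleftrightarrow> v \<in> Y"
        using disjointD[OF partition_onD2[OF Q] that(1) Y(1)] that(2,3) by blast
      ultimately show ?thesis by (simp add: z_def)
    qed
    moreover have "z \<in> coord_space V" by (simp add: z_def coord_space_def)
    ultimately have "z \<in> partition_flat V Q" by (intro partition_flatI)
    with sub have zP: "z \<in> partition_flat V P" by blast
    have "v \<in> Y" if v: "v \<in> X" for v
    proof -
      have "z v = z x" by (rule partition_flatD(2)[OF zP X v x])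
      moreover have "v \<in> V" "x \<in> V" using v x XV by auto
      ultimately show ?thesis using Y(2) by (simp add: z_def)
    qed
    with Y(1) show ?thesis by blast
  qed
  with P Q show "refines V P Q" by (simp add: refines_def)
qed

text \<open>The hyperplanes to intersect are those of the arcs with both ends in one block. As the
  blocks are connected, equality along these arcs spreads over each whole block.\<close>

lemma partition_flat_in_intersection_poset:
  assumes G: "pair_graph \<Gamma>" and \<pi>: "\<pi> \<in> bond_lattice \<Gamma>"
  shows "partition_flat (pverts \<Gamma>) \<pi>
    \<in> intersection_poset (coord_space (pverts \<Gamma>)) (graphical_arrangement \<Gamma>)"
proof -
  let ?V = "pverts \<Gamma>"
  let ?H = "\<lambda>u v. {z \<in> coord_space ?V. z u = z v}"
  define B where "B = (\<lambda>(u, v). ?H u v) ` (\<Union>C\<in>\<pi>. parcs \<Gamma> \<inter> C \<times> C)"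
  have "B \<subseteq> graphical_arrangement \<Gamma>"
    unfolding B_def graphical_arrangement_def by auto
  moreover have "partition_flat ?V \<pi> = coord_space ?V \<inter> \<Inter>B"
  proof (intro equalityI subsetI)
    fix z assume z: "z \<in> coord_space ?V \<inter> \<Inter>B"
    have "z u = z v" if C: "C \<in> \<pi>" "u \<in> C" "v \<in> C" for C u v
    proof -
      have "(u, v) \<in> (parcs \<Gamma> \<inter> C \<times> C)\<^sup>*"
        using \<pi> C by (simp add: bond_lattice_def connected_induce_subgraph_iff[OF G])
      then show ?thesis
      proof induction
        case (step v w)
        then have "?H v w \<in> B"
          unfolding B_def using C(1) by (intro image_eqI[of _ _ "(v, w)"]) auto
        with z have "z v = z w" by blast
        with step.IH show ?case by simp
      qed simp
    qed
    then show "z \<in> partition_flat ?V \<pi>" by (rule partition_flatI[OF IntD1[OF z]])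
  next
    fix z assume z: "z \<in> partition_flat ?V \<pi>"
    have "z \<in> ?H u v" if "C \<in> \<pi>" "(u, v) \<in> parcs \<Gamma> \<inter> C \<times> C" for C u v
      using partition_flatD(1)[OF z] partition_flatD(2)[OF z that(1), of u v] that(2) by auto
    then show "z \<in> coord_space ?V \<inter> \<Inter>B"
      using partition_flatD(1)[OF z] unfolding B_def by auto
  qed
  \<comment> \<open>The zero vector witnesses that the flat is nonempty, as membership in the
    intersection poset demands.\<close>
  moreover have "restrict (\<lambda>_. 0) ?V \<in> partition_flat ?V \<pi>"
  proof -
    have "C \<subseteq> ?V" if "C \<in> \<pi>" for C
      using \<pi> that by (auto simp: bond_lattice_def partition_on_def)
    then show ?thesis
      by (intro partition_flatI) (auto simp: coord_space_def restrict_def)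
  qed
  ultimately show ?thesis unfolding intersection_poset_def by blast
qed

text \<open>The bond consists of the connected components of the spanning subgraph whose arcs have
  their hyperplane in the chosen family; isolated vertices become singleton blocks.\<close>

lemma in_intersection_poset_imp_partition_flat:
  assumes G: "pair_graph \<Gamma>"
    and X: "X \<in> intersection_poset (coord_space (pverts \<Gamma>)) (graphical_arrangement \<Gamma>)"
  shows "\<exists>\<pi>\<in>bond_lattice \<Gamma>. X = partition_flat (pverts \<Gamma>) \<pi>"
proof -
  interpret pair_graph \<Gamma> by fact
  let ?V = "pverts \<Gamma>"
  let ?H = "\<lambda>u v. {z \<in> coord_space ?V. z u = z v}"
  obtain B where B: "B \<subseteq> graphical_arrangement \<Gamma>" "X = coord_space ?V \<inter> \<Inter>B"
    using X unfolding intersection_poset_def by blast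
  \<comment> \<open>Both orientations of an edge define the same hyperplane, so selecting arcs by
    their hyperplane gives a symmetric relation.\<close>
  define R where "R = {(u, v) \<in> parcs \<Gamma>. ?H u v \<in> B}"
  have H_commute: "?H u v = ?H v u" for u v by auto
  have "sym R"
    using pair_sym_arcs H_commute unfolding R_def symmetric_def sym_def by auto
  then have symR: "sym (R\<^sup>*)" by (rule sym_rtrancl)
  have R_V: "u \<in> ?V \<and> v \<in> ?V" if "(u, v) \<in> R" for u v
    using that wellformed' unfolding R_def by blast
  \<comment> \<open>The closure \<open>R\<^sup>*\<close> also relates every element outside
    \<open>?V\<close> to itself; cutting down to \<open>?V\<close> makes it an equivalence on
    \<open>?V\<close>.\<close>
  define r where "r = R\<^sup>* \<inter> ?V \<times> ?V"
  have r: "equiv ?V r"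
    using symR unfolding r_def by (auto simp: equiv_def refl_on_def sym_def trans_def)
  have eq_on_R: "z u = z v" if "z \<in> X" "(u, v) \<in> R\<^sup>*" for z u v
    using that(2)
  proof induction
    case (step v w)
    then have "?H v w \<in> B" by (simp add: R_def)
    with that(1) B(2) have "z v = z w" by blast
    with step.IH show ?case by simp
  qed simp
  have "Digraph_Component.connected (with_proj \<Gamma> \<restriction> C)" if C: "C \<in> ?V // r" for C
  proof -
    obtain a where a: "a \<in> ?V" "C = r `` {a}" using C by (auto elim: quotientE)
    have "(u, v) \<in> (parcs \<Gamma> \<inter> C \<times> C)\<^sup>*" if u: "u \<in> C" and v: "v \<in> C" for u v
    proof -
      have "(u, v) \<in> R\<^sup>*"
        using quotient_eq_iff[OF r C C u v] by (simp add: r_def)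
      then show ?thesis
      proof (induction rule: rtrancl_induct)
        case (step v w)
        \<comment> \<open>The walk from \<open>u\<close> never leaves \<open>C\<close>: each of its
          vertices is reachable from the representative \<open>a\<close>. Hence its arcs survive in
          the induced subgraph.\<close>
        have "(a, u) \<in> R\<^sup>*" using u a by (simp add: r_def)
        with step.hyps have "(a, v) \<in> R\<^sup>*" "(a, w) \<in> R\<^sup>*" by auto
        then have "v \<in> C" "w \<in> C" using a R_V[OF step.hyps(2)] by (auto simp: r_def)
        moreover have "(v, w) \<in> parcs \<Gamma>" using step.hyps(2) by (simp add: R_def)
        ultimately show ?case using step.IH by (auto intro: rtrancl_into_rtrancl)
      qed simp
    qed
    moreover have "C \<noteq> {}" using r C by (rule in_quotient_imp_non_empty)
    ultimately show ?thesis by (simp add: connected_induce_subgraph_iff[OF G])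
  qed
  then have "?V // r \<in> bond_lattice \<Gamma>"
    using partition_on_quotient[OF r] by (simp add: bond_lattice_def)
  moreover have "X = partition_flat ?V (?V // r)"
  proof (intro equalityI subsetI)
    fix z assume z: "z \<in> X"
    have "z u = z v" if "C \<in> ?V // r" "u \<in> C" "v \<in> C" for C u v
    proof (rule eq_on_R[OF z])
      show "(u, v) \<in> R\<^sup>*"
        using quotient_eq_iff[OF r that(1) that(1) that(2,3)] by (simp add: r_def)
    qed
    moreover have "z \<in> coord_space ?V" using z B(2) by simp
    ultimately show "z \<in> partition_flat ?V (?V // r)" by (rule partition_flatI[rotated])
  next
    fix z assume z: "z \<in> partition_flat ?V (?V // r)"
    have "z \<in> K" if K: "K \<in> B" for K
    proof -
      obtain u v where uv: "(u, v) \<in> parcs \<Gamma>" "K = ?H u v"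
        using K B(1) unfolding graphical_arrangement_def by blast
      then have R: "(u, v) \<in> R" using K by (simp add: R_def)
      have "r `` {u} \<in> ?V // r" "u \<in> r `` {u}" "v \<in> r `` {u}"
        using R R_V[OF R] by (auto simp: r_def quotientI)
      then have "z u = z v" by (rule partition_flatD(2)[OF z])
      with partition_flatD(1)[OF z] uv(2) show ?thesis by simp
    qed
    with partition_flatD(1)[OF z] B(2) show "z \<in> X" by blast
  qed
  ultimately show ?thesis by blast
qed

theorem graphical_intersection_poset_isomorphic_bond_lattice:
  assumes "pair_graph \<Gamma>"
  shows "poset_isomorphic
    (intersection_poset (coord_space (pverts \<Gamma>)) (graphical_arrangement \<Gamma>)) rev_incl
    (bond_lattice \<Gamma>) (refines (pverts \<Gamma>))"
\<comment> \<open>The explicit map goes from bonds to flats, so the isomorphism is built in that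
  direction and then inverted.\<close>
proof (rule poset_isomorphic_sym, rule poset_isomorphic_surj_embedding)
  show "partition_flat (pverts \<Gamma>) ` bond_lattice \<Gamma> =
      intersection_poset (coord_space (pverts \<Gamma>)) (graphical_arrangement \<Gamma>)"
    using partition_flat_in_intersection_poset[OF assms]
      in_intersection_poset_imp_partition_flat[OF assms] by blast
  show "refines (pverts \<Gamma>) P Q \<longleftrightarrow>
      rev_incl (partition_flat (pverts \<Gamma>) P) (partition_flat (pverts \<Gamma>) Q)"
    if "P \<in> bond_lattice \<Gamma>" "Q \<in> bond_lattice \<Gamma>" for P Q
    using that refines_iff_partition_flat unfolding bond_lattice_def rev_incl_def by blast
  show "P = Q" if "refines (pverts \<Gamma>) P Q" "refines (pverts \<Gamma>) Q P" for P Q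
    using that by (rule refines_asym)
qed (simp add: rev_incl_def)

section \<open>The change of coordinates from the Shi arrangement to the graphical one\<close>

text \<open>The index \<open>n - k div 2\<close> is \<open>i\<close> for
  \<open>k = 2*n - 2*i + 1\<close> and \<open>m\<close> for \<open>k = 2*(n - m)\<close>; since
  \<open>k\<close> is at most \<open>2*n - 1\<close>, it is at least 1. The entry at
  \<open>n + m\<close> is y_m.\<close>

definition shi_coords :: "nat \<Rightarrow> (nat \<Rightarrow> real) \<Rightarrow> nat \<Rightarrow> real" where
  "shi_coords n p = (\<lambda>k\<in>{1..2*n-1}.
     if odd k then p (n - k div 2) else p (n - k div 2) - p (n + (n - k div 2)))"

lemma shi_coords_odd:
  assumes "1 \<le> i" and "i \<le> n"
  shows "shi_coords n p (2*n - 2*i + 1) = p i"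
proof -
  have "2*n - 2*i + 1 = 2*(n - i) + 1" using assms by simp
  moreover have "2*(n - i) + 1 \<in> {1..2*n-1}" using assms by auto
  ultimately show ?thesis using assms by (simp add: shi_coords_def)
qed

lemma shi_coords_even:
  assumes "1 \<le> m" and "m < n"
  shows "shi_coords n p (2*(n - m)) = p m - p (n + m)"
proof -
  have "2*(n - m) \<in> {1..2*n-1}" using assms by auto
  then show ?thesis using assms by (simp add: shi_coords_def)
qed

lemma bij_betw_shi_coords:
  "bij_betw (shi_coords n) (coord_space {1..2*n-1}) (coord_space {1..2*n-1})"
proof -
  \<comment> \<open>The inverse map: x_k is read off at the odd vertex of \<open>k\<close>, and for
    \<open>k > n\<close> the coordinate y_m with \<open>m = k - n\<close> is x_m minus the value x_m
    - y_m at the even vertex of \<open>m\<close>.\<close>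
  define g :: "(nat \<Rightarrow> real) \<Rightarrow> nat \<Rightarrow> real" where "g z = (\<lambda>k\<in>{1..2*n-1}.
     if k \<le> n then z (2*n - 2*k + 1) else z (2*n - 2*(k - n) + 1) - z (2*(n - (k - n))))" for z
  have V: "shi_coords n p \<in> coord_space {1..2*n-1}" "g p \<in> coord_space {1..2*n-1}" for p
    by (auto simp: shi_coords_def g_def coord_space_def)
  have "g (shi_coords n p) = p" if "p \<in> coord_space {1..2*n-1}" for p
  proof (rule PiE_ext)
    fix k assume k: "k \<in> {1..2*n-1}"
    show "g (shi_coords n p) k = p k"
    proof (cases "k \<le> n")
      case True
      then show ?thesis using k shi_coords_odd[of k n p] by (simp add: g_def)
    next
      case False
      then have "1 \<le> k - n" "k - n < n" using k by auto
      then have "shi_coords n p (2*n - 2*(k - n) + 1) = p (k - n)"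
        "shi_coords n p (2*(n - (k - n))) = p (k - n) - p k"
        using shi_coords_odd[of "k - n" n p] shi_coords_even[of "k - n" n p] False by auto
      then show ?thesis using k False by (simp add: g_def)
    qed
  qed (use V that in \<open>auto simp: coord_space_def\<close>)
  moreover have "shi_coords n (g z) = z" if "z \<in> coord_space {1..2*n-1}" for z
  proof (rule PiE_ext)
    fix k assume k: "k \<in> {1..2*n-1}"
    define m where "m = n - k div 2"
    have m: "1 \<le> m" "m \<le> n" using k by (auto simp: m_def)
    then have gm: "g z m = z (2*n - 2*m + 1)" by (auto simp: g_def)
    show "shi_coords n (g z) k = z k"
    proof (cases "odd k")
      case True
      then have "k = 2*n - 2*m + 1" using k unfolding m_def by (auto elim!: oddE)
      then show ?thesis using shi_coords_odd[OF m] gm by simp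
    next
      case False
      \<comment> \<open>An even \<open>k\<close> in the range is at least 2, which forces
        \<open>m < n\<close>, so that y_m exists.\<close>
      then have km: "k = 2*(n - m)" "m < n" using k unfolding m_def by (auto elim!: evenE)
      have "n + m \<in> {1..2*n-1}" "\<not> n + m \<le> n" using m km by auto
      then have "g z (n + m) = z (2*n - 2*m + 1) - z (2*(n - m))" by (simp add: g_def)
      then show ?thesis using shi_coords_even[OF m(1) km(2)] gm km(1) by simp
    qed
  qed (use V that in \<open>auto simp: coord_space_def\<close>)
  ultimately show ?thesis
    using V by (intro bij_betw_byWitness[where f' = g]) auto
qed

text \<open>The defining equations are matched one by one. The arcs of \<open>Gamma\<close> come in
  both orientations while the Shi hyperplanes are listed for \<open>i < j\<close> only, so both
  inclusions are needed at the level of sets of hyperplanes.\<close>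

lemma shi_coords_image_arrangement:
  assumes "pair_graph G" and "pverts G = {1..n}"
  shows "(`) (shi_coords n) ` hom_shi_arrangement n G = graphical_arrangement (Gamma n G)"
proof -
  interpret pair_graph G by fact
  let ?V = "coord_space {1..2*n-1} :: (nat \<Rightarrow> real) set"
  let ?H = "\<lambda>u v. {z \<in> ?V. z u = z v}"
  have arc: "i \<in> {1..n}" "j \<in> {1..n}" "i \<noteq> j" "(j, i) \<in> parcs G" if "(i, j) \<in> parcs G" for i j
    using wellformed'[OF that] no_loops[OF that] pair_sym_arcs that assms(2)
    by (auto simp: symmetric_def elim: symE)
  have verts: "pverts (Gamma n G) = {1..2*n-1}" by (simp add: Gamma_def)
  have H_commute: "?H u v = ?H v u" for u v by auto
  have x: "shi_coords n ` {p \<in> ?V. p i - p j = 0} = ?H (2*n - 2*i + 1) (2*n - 2*j + 1)"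
    if "(i, j) \<in> parcs G" for i j
    by (rule image_Collect_bij_betw[OF bij_betw_shi_coords])
      (use arc[OF that] shi_coords_odd in auto)
  \<comment> \<open>The equation x_m - x_j = y_m is rearranged to x_j = x_m - y_m, an equality
    between an odd and an even coordinate.\<close>
  have y: "shi_coords n ` {p \<in> ?V. p m - p j = p (n + m)} = ?H (2*n - 2*j + 1) (2*(n - m))"
    if "1 \<le> m" "m < j" "j \<le> n" for m j
  proof (rule image_Collect_bij_betw[OF bij_betw_shi_coords])
    fix p
    have "shi_coords n p (2*n - 2*j + 1) = p j" "shi_coords n p (2*(n - m)) = p m - p (n + m)"
      using that shi_coords_odd[of j n p] shi_coords_even[of m n p] by auto
    then show "p m - p j = p (n + m) \<longleftrightarrow>
        shi_coords n p (2*n - 2*j + 1) = shi_coords n p (2*(n - m))"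
      by auto
  qed
  show ?thesis
  proof (intro equalityI subsetI)
    fix K assume "K \<in> (`) (shi_coords n) ` hom_shi_arrangement n G"
    then consider
        (x) i j where "(i, j) \<in> parcs G" "K = shi_coords n ` {p \<in> ?V. p i - p j = 0}"
      | (y) m j where "1 \<le> m" "m < j" "j \<le> n" "K = shi_coords n ` {p \<in> ?V. p m - p j = p (n + m)}"
      unfolding hom_shi_arrangement_def by blast
    then show "K \<in> graphical_arrangement (Gamma n G)"
    proof cases
      case x': x
      have "(2*n - 2*i + 1, 2*n - 2*j + 1) \<in> parcs (Gamma n G)"
        using x'(1) by (auto simp: Gamma_def)
      then show ?thesis
        unfolding x'(2) x[OF x'(1)] graphical_arrangement_def verts by blast
    next
      case y': y
      \<comment> \<open>In the form \<open>(2*i - 1, 2*j)\<close> of the definition of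
        \<open>Gamma\<close>, the arc has parameters \<open>n - j + 1\<close> and
        \<open>n - m\<close>; the condition that the first is at most the second is exactly
        \<open>m < j\<close>.\<close>
      have "2*n - 2*j + 1 = 2*(n - j + 1) - 1" "1 \<le> n - j + 1" "n - j + 1 \<le> n - m" "n - m \<le> n - 1"
        using y'(1-3) by auto
      then have "(2*n - 2*j + 1, 2*(n - m)) \<in> parcs (Gamma n G)"
        unfolding Gamma_def pair_pre_digraph.simps by blast
      then show ?thesis
        unfolding y'(4) y[OF y'(1-3)] graphical_arrangement_def verts by blast
    qed
  next
    fix K assume "K \<in> graphical_arrangement (Gamma n G)"
    then obtain u v where uv: "(u, v) \<in> parcs (Gamma n G)" "K = ?H u v"
      unfolding graphical_arrangement_def verts by blast
    have "(\<exists>i j. (i, j) \<in> parcs G \<and> K = ?H (2*n - 2*i + 1) (2*n - 2*j + 1)) \<or>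
        (\<exists>i j. 1 \<le> i \<and> i \<le> j \<and> j \<le> n - 1 \<and> K = ?H (2*i - 1) (2*j))"
      using uv H_commute unfolding Gamma_def pair_pre_digraph.simps by blast
    then consider
        (x) i j where "(i, j) \<in> parcs G" "K = ?H (2*n - 2*i + 1) (2*n - 2*j + 1)"
      | (y) i j where "1 \<le> i" "i \<le> j" "j \<le> n - 1" "K = ?H (2*i - 1) (2*j)"
      by blast
    then show "K \<in> (`) (shi_coords n) ` hom_shi_arrangement n G"
    proof cases
      case x': x
      have mem: "?H (2*n - 2*k + 1) (2*n - 2*l + 1) \<in> (`) (shi_coords n) ` hom_shi_arrangement n G"
        if "k < l" "(k, l) \<in> parcs G" for k l
      proof -
        have "{p \<in> ?V. p k - p l = 0} \<in> hom_shi_arrangement n G"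
          unfolding hom_shi_arrangement_def using that by blast
        then show ?thesis unfolding x[OF that(2), symmetric] by (rule imageI)
      qed
      show ?thesis
      proof (cases "i < j")
        case True
        then show ?thesis unfolding x'(2) using x'(1) by (rule mem)
      next
        \<comment> \<open>The arc points the other way; its reverse has the same hyperplane and the
          index order that the Shi arrangement lists.\<close>
        case False
        with arc(3)[OF x'(1)] have "j < i" by simp
        then show ?thesis
          unfolding x'(2) H_commute[of "2*n - 2*i + 1"] using arc(4)[OF x'(1)] by (rule mem)
      qed
    next
      case y': y
      \<comment> \<open>These invert the substitution of the other inclusion:
        \<open>i \<le> j\<close> turns into the strict inequality \<open>m < l\<close>, because of
        the added 1 in \<open>l\<close>.\<close>
      define m where "m = n - j"
      define l where "l = n - i + 1"
      have ml: "1 \<le> m" "m < l" "l \<le> n" "2*n - 2*l + 1 = 2*i - 1" "n - m = j"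
        using y'(1-3) unfolding m_def l_def by auto
      then have "{p \<in> ?V. p m - p l = p (n + m)} \<in> hom_shi_arrangement n G"
        unfolding hom_shi_arrangement_def by blast
      moreover have "K = shi_coords n ` {p \<in> ?V. p m - p l = p (n + m)}"
        unfolding y[OF ml(1-3)] ml(4,5) by (rule y'(4))
      ultimately show ?thesis by (rule rev_image_eqI)
    qed
  qed
qed

theorem theorem3p1:
  fixes n :: nat and G :: "nat pair_pre_digraph"
  assumes "n \<ge> 1" and "pair_graph G" and "pverts G = {1..n}"
  shows "poset_isomorphic
           (intersection_poset (coord_space {1..2*n-1}) (hom_shi_arrangement n G)) rev_incl
           (intersection_poset (coord_space {1..2*n-1}) (graphical_arrangement (Gamma n G))) rev_incl
       \<and> poset_isomorphic
           (intersection_poset (coord_space {1..2*n-1}) (graphical_arrangement (Gamma n G))) rev_incl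
           (bond_lattice (Gamma n G)) (refines {1..2*n-1})"
proof
  show "poset_isomorphic
      (intersection_poset (coord_space {1..2*n-1}) (hom_shi_arrangement n G)) rev_incl
      (intersection_poset (coord_space {1..2*n-1}) (graphical_arrangement (Gamma n G))) rev_incl"
    by (rule poset_isomorphic_intersection_poset[OF bij_betw_shi_coords
          shi_coords_image_arrangement[OF assms(2,3)]])
      (auto simp: hom_shi_arrangement_def)
  have "pverts (Gamma n G) = {1..2*n-1}" by (simp add: Gamma_def)
  then show "poset_isomorphic
      (intersection_poset (coord_space {1..2*n-1}) (graphical_arrangement (Gamma n G))) rev_incl
      (bond_lattice (Gamma n G)) (refines {1..2*n-1})"
    using graphical_intersection_poset_isomorphic_bond_lattice[OF pair_graph_Gamma[OF assms(2,3)]]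
    by simp
qed

end
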